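(* Let $n\ge1$, let $0<\beta_i\le1$ for $1\le i\le n$, let $\beta:=\max\{\beta_1,\ldots,\beta_n\}$, and let $M>0$. Consider the class of all functions $$F(z):=\int_0^z\prod_{i=1}^n\left(f_i'(t)\right)^{\gamma_i}\,dt\qquad(z\in\Delta),$$ where $f_i\in\mathcal{G}(\beta_i)$ $(1\le i\le n)$ and $\gamma_1,\ldots,\gamma_n\in\mathbb{C}$ satisfy $\sum_{i=1}^n|\gamma_i|\le M$. Then the radius of convexity of this class of integral operators is $$r=\frac{1}{\beta M+1}.$$
   Context: $\Delta=\{z\in\mathbb{C}:|z|<1\}$. $\mathcal{A}$ is the set of functions $f$ analytic in $\Delta$ with $f(z)=z+a_2z^2+\cdots$. For $\beta\in\mathbb{R}$, $\mathcal{G}(\beta)$ is the class of locally univalent $f\in\mathcal{A}$ (i.e. $f'\ne0$ in $\Delta$) satisfying $\mathrm{Re}\left(1+\frac{zf''(z)}{f'(z)}\right)<1+\frac{\beta}{2}$ for $z\in\Delta$. The powers $(f_i')^{\gamma_i}$ are the analytic branches equal to $1$ at the origin. The radius of convexity of a class of such functions $F$ is the largest number $r\in(0,1)$ for which $\min_{|z|=r}\mathrm{Re}\left\{1+\frac{zF''(z)}{F'(z)}\right\}\ge 0$ for every $F$ in the class. *)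

theory Defs
  imports "HOL-Complex_Analysis.Complex_Analysis"
begin

abbreviation unit_disc :: "complex set" where
  "unit_disc \<equiv> ball 0 1"

definition class_A :: "(complex \<Rightarrow> complex) set" where
  "class_A = {f. f holomorphic_on unit_disc \<and> f 0 = 0 \<and> deriv f 0 = 1}"

definition class_G :: "real \<Rightarrow> (complex \<Rightarrow> complex) set" where
  "class_G \<beta> = {f \<in> class_A. \<forall>z\<in>unit_disc. deriv f z \<noteq> 0 \<and>
     Re (1 + z * deriv (deriv f) z / deriv f z) < 1 + \<beta> / 2}"

text \<open>
  \<open>is_power_branch g c h\<close>: on the unit disc, \<open>h\<close> is the analytic branch of \<open>g\<close> to the complex
  power \<open>c\<close> with value 1 at the origin. Branches of the power come from branches \<open>L\<close> of the
  logarithm of \<open>g\<close>; two such \<open>L\<close> differ by a constant, so \<open>h\<close> is unique on the disc.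
  HOL's \<open>powr\<close> is unsuitable here, as it uses the principal logarithm, which jumps when \<open>g\<close>
  crosses the negative real axis.
\<close>

definition is_power_branch ::
    "(complex \<Rightarrow> complex) \<Rightarrow> complex \<Rightarrow> (complex \<Rightarrow> complex) \<Rightarrow> bool" where
  "is_power_branch g c h \<longleftrightarrow> h 0 = 1 \<and>
     (\<exists>L. L holomorphic_on unit_disc \<and>
        (\<forall>z\<in>unit_disc. exp (L z) = g z \<and> h z = exp (c * L z)))"

text \<open>
  Here \<open>n\<close>, the parameters \<open>\<beta> 1, \<dots>, \<beta> n\<close> and \<open>M\<close> are fixed, while the functions \<open>f i\<close> and the
  exponents \<open>\<gamma> i\<close> range over everything admissible. Members are only constrained on the unit disc.
\<close>

definition integral_operator_class ::
    "nat \<Rightarrow> (nat \<Rightarrow> real) \<Rightarrow> real \<Rightarrow> (complex \<Rightarrow> complex) set" where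
  "integral_operator_class n \<beta> M = {F. \<exists>f \<gamma> h.
     (\<forall>i\<in>{1..n}. f i \<in> class_G (\<beta> i)) \<and>
     (\<Sum>i=1..n. norm (\<gamma> i :: complex)) \<le> M \<and>
     (\<forall>i\<in>{1..n}. is_power_branch (deriv (f i)) (\<gamma> i) (h i)) \<and>
     (\<forall>z\<in>unit_disc. F z = contour_integral (linepath 0 z) (\<lambda>t. \<Prod>i=1..n. h i t))}"

definition convexity_expr :: "(complex \<Rightarrow> complex) \<Rightarrow> complex \<Rightarrow> real" where
  "convexity_expr F z = Re (1 + z * deriv (deriv F) z / deriv F z)"

definition nonneg_min_on_circle :: "(complex \<Rightarrow> complex) \<Rightarrow> real \<Rightarrow> bool" where
  "nonneg_min_on_circle F r \<longleftrightarrow>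
     (\<exists>w. is_arg_min (convexity_expr F) (\<lambda>z. z \<in> sphere 0 r) w \<and> 0 \<le> convexity_expr F w)"

text \<open>
  A relation rather than a function, so that asserting it includes that the greatest such
  radius exists. Intended for classes of locally univalent functions: elsewhere the division
  in \<open>convexity_expr\<close> may be by zero.
\<close>

definition is_radius_of_convexity :: "(complex \<Rightarrow> complex) set \<Rightarrow> real \<Rightarrow> bool" where
  "is_radius_of_convexity C r \<longleftrightarrow>
     r \<in> {0<..<1} \<and> (\<forall>F\<in>C. nonneg_min_on_circle F r) \<and>
     (\<forall>s\<in>{0<..<1}. (\<forall>F\<in>C. nonneg_min_on_circle F s) \<longrightarrow> s \<le> r)"

end

theory Submission
  imports Defs
begin

text \<open>
  Write \<open>f\<^sub>i' = exp L\<^sub>i\<close>, so that \<open>F' = exp (\<Sum> \<gamma>\<^sub>i L\<^sub>i)\<close> and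
  \<open>z F'' / F' = \<Sum> \<gamma>\<^sub>i p\<^sub>i\<close> with \<open>p\<^sub>i = z L\<^sub>i'\<close>. Each \<open>p\<^sub>i\<close> vanishes at the origin and
  maps the disc into the half-plane \<open>Re < \<beta>\<^sub>i / 2\<close>, so the Schwarz lemma applied to
  \<open>p\<^sub>i / (p\<^sub>i - \<beta>\<^sub>i)\<close> gives \<open>\<bar>p\<^sub>i\<bar> \<le> \<beta>\<^sub>i \<bar>z\<bar> / (1 - \<bar>z\<bar>)\<close>. Hence
  \<open>Re (1 + z F'' / F') \<ge> 1 - \<beta> M \<bar>z\<bar> / (1 - \<bar>z\<bar>)\<close>, which is nonnegative as long as
  \<open>\<bar>z\<bar> \<le> 1 / (\<beta> M + 1)\<close>. Equality at positive \<open>z\<close> is attained by \<open>f' = (1 - z)\<^sup>\<beta>\<close> with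
  the whole weight \<open>M\<close> put on an index of maximal \<open>\<beta>\<^sub>i\<close>.
\<close>

section \<open>Holomorphic logarithms of derivatives\<close>

text \<open>A logarithm turns the quotient into an expression linear in \<open>L\<close>, so that
  products of complex powers later become weighted sums.\<close>

lemma log_deriv_of_exp:
  assumes L: "L holomorphic_on unit_disc"
    and f: "\<And>z. z \<in> unit_disc \<Longrightarrow> deriv f z = exp (L z)"
    and z: "z \<in> unit_disc"
  shows "deriv (deriv f) z / deriv f z = deriv L z"
proof -
  have ev: "\<forall>\<^sub>F w in nhds z. deriv f w = exp (L w)"
    using f z by (intro eventually_nhds_in_open[THEN eventually_mono, of unit_disc]) auto
  have "(L has_field_derivative deriv L z) (at z)"
    using L z holomorphic_derivI open_ball by blast
  then have "((\<lambda>w. exp (L w)) has_field_derivative exp (L z) * deriv L z) (at z)"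
    by (rule DERIV_fun_exp)
  then have "deriv (\<lambda>w. exp (L w)) z = exp (L z) * deriv L z"
    by (rule DERIV_imp_deriv)
  moreover have "deriv (deriv f) z = deriv (\<lambda>w. exp (L w)) z"
    using ev by (intro deriv_cong_ev) auto
  ultimately show ?thesis
    using f z by simp
qed

lemma convexity_expr_of_exp:
  assumes "L holomorphic_on unit_disc"
    and "\<And>z. z \<in> unit_disc \<Longrightarrow> deriv f z = exp (L z)"
    and "z \<in> unit_disc"
  shows "convexity_expr f z = Re (1 + z * deriv L z)"
  using log_deriv_of_exp[OF assms] by (simp add: convexity_expr_def flip: times_divide_eq_right)

section \<open>Schwarz bound for maps into a half-plane\<close>

text \<open>The half-plane consists of the points closer to 0 than to \<open>b\<close>, so the
  Moebius map in \<open>w\<close> sends it into the unit disc and fixes 0.\<close>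

lemma norm_le_of_Re_less:
  fixes b :: real
  assumes b: "b > 0"
    and p: "p holomorphic_on unit_disc" "p 0 = 0"
    and Re_p: "\<And>z. z \<in> unit_disc \<Longrightarrow> Re (p z) < b / 2"
    and z: "z \<in> unit_disc"
  shows "norm (p z) \<le> b * norm z / (1 - norm z)"
proof -
  define w where "w \<zeta> = p \<zeta> / (p \<zeta> - b)" for \<zeta>
  have ne: "p \<zeta> - b \<noteq> 0" if "\<zeta> \<in> unit_disc" for \<zeta>
    using Re_p[OF that] b by auto
  have "w holomorphic_on unit_disc"
    unfolding w_def using ne by (intro holomorphic_intros p) auto
  moreover have "w 0 = 0"
    by (simp add: w_def p)
  moreover have "norm (w \<zeta>) < 1" if "norm \<zeta> < 1" for \<zeta>
  proof -
    have \<zeta>: "\<zeta> \<in> unit_disc"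
      using that by simp
    \<comment> \<open>Uses \<open>|p - b|^2 - |p|^2 = b^2 - 2 b Re p\<close>.\<close>
    have "b * (2 * Re (p \<zeta>)) < b * b"
      using Re_p[OF \<zeta>] b by (intro mult_strict_left_mono) auto
    then have "(norm (p \<zeta>))\<^sup>2 < (norm (p \<zeta> - b))\<^sup>2"
      unfolding cmod_power2 by (simp add: power2_eq_square algebra_simps)
    then have "norm (p \<zeta>) < norm (p \<zeta> - b)"
      by (rule power_less_imp_less_base) simp
    then show ?thesis
      using ne[OF \<zeta>] by (simp add: w_def norm_divide)
  qed
  ultimately have wz: "norm (w z) \<le> norm z"
    using z by (intro Schwarz_Lemma(1)) auto
  have "p z = w z * (p z - b)"
    using ne[OF z] by (simp add: w_def)
  then have "norm (p z) = norm (w z) * norm (p z - b)"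
    by (metis norm_mult)
  \<comment> \<open>The resulting inequality is linear in \<open>norm (p z)\<close> and can be
    solved for it because \<open>norm z < 1\<close>.\<close>
  also have "\<dots> \<le> norm z * (norm (p z) + b)"
    using wz norm_triangle_ineq4[of "p z" "of_real b"] b by (intro mult_mono) auto
  finally show ?thesis
    using z by (simp add: field_simps)
qed

text \<open>With the 1 cancelled, the inequality defining \<open>class_G b\<close> confines
  \<open>z * deriv L z\<close> to the half-plane; the factor \<open>z\<close> supplies the zero at
  the origin.\<close>

lemma class_G_log_deriv_bound:
  assumes b: "b > 0" and f: "f \<in> class_G b"
    and L: "L holomorphic_on unit_disc"
      "\<And>z. z \<in> unit_disc \<Longrightarrow> deriv f z = exp (L z)"
    and z: "z \<in> unit_disc"
  shows "norm (z * deriv L z) \<le> b * norm z / (1 - norm z)"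
proof (rule norm_le_of_Re_less[OF b _ _ _ z])
  show "(\<lambda>z. z * deriv L z) holomorphic_on unit_disc"
    by (intro holomorphic_intros holomorphic_deriv L) auto
  show "Re (\<zeta> * deriv L \<zeta>) < b / 2" if "\<zeta> \<in> unit_disc" for \<zeta>
    using f that convexity_expr_of_exp[OF L that] unfolding class_G_def convexity_expr_def
    by fastforce
qed simp

section \<open>The integral operator and its derivative\<close>

text \<open>The disc is convex, so \<open>H\<close> has a primitive there, and \<open>F\<close>
  agrees with it up to a constant.\<close>

lemma deriv_integral_of_exp:
  assumes S: "S holomorphic_on unit_disc"
    and H: "\<And>z. z \<in> unit_disc \<Longrightarrow> H z = exp (S z)"
    and F: "\<And>z. z \<in> unit_disc \<Longrightarrow> F z = contour_integral (linepath 0 z) H"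
    and z: "z \<in> unit_disc"
  shows "deriv F z = exp (S z)"
proof -
  have "(\<lambda>z. exp (S z)) holomorphic_on unit_disc"
    by (intro holomorphic_intros S)
  then have "H holomorphic_on unit_disc"
    using H by (metis holomorphic_transform)
  then obtain G where G: "\<And>z. z \<in> unit_disc \<Longrightarrow> (G has_field_derivative H z) (at z)"
    using holomorphic_convex_primitive'[of unit_disc H]
    by (metis at_within_open convex_ball open_ball)
  have FG: "F w = G w - G 0" if "w \<in> unit_disc" for w
  proof -
    have "path_image (linepath 0 w) \<subseteq> unit_disc"
      using that by (simp add: closed_segment_subset)
    then have "(H has_contour_integral G w - G 0) (linepath 0 w)"
      using contour_integral_primitive[of unit_disc G H "linepath 0 w"] G
        has_field_derivative_at_within by fastforce
    then show ?thesis
      using F[OF that] by (simp add: contour_integral_unique)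
  qed
  have "((\<lambda>z. G z - G 0) has_field_derivative H z) (at z)"
    using G[OF z] by (auto intro!: derivative_eq_intros)
  then have "(F has_field_derivative H z) (at z)"
    by (rule has_field_derivative_transform_within_open[of _ _ _ unit_disc])
      (use z FG in auto)
  then show ?thesis
    using H[OF z] by (simp add: DERIV_imp_deriv)
qed

text \<open>Trades the branches \<open>h i\<close> for logarithms: their product is the exponential
  of one weighted sum, a logarithm of \<open>deriv F\<close>.\<close>

lemma integral_operator_class_log_deriv:
  assumes F: "F \<in> integral_operator_class n \<beta> M"
  obtains f \<gamma> L where
    "\<And>i. i \<in> {1..n} \<Longrightarrow> f i \<in> class_G (\<beta> i)"
    "(\<Sum>i=1..n. norm (\<gamma> i :: complex)) \<le> M"
    "\<And>i. i \<in> {1..n} \<Longrightarrow> L i holomorphic_on unit_disc"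
    "\<And>i z. i \<in> {1..n} \<Longrightarrow> z \<in> unit_disc \<Longrightarrow> deriv (f i) z = exp (L i z)"
    "\<And>z. z \<in> unit_disc \<Longrightarrow> deriv F z = exp (\<Sum>i=1..n. \<gamma> i * L i z)"
proof -
  obtain f \<gamma> h where f: "\<And>i. i \<in> {1..n} \<Longrightarrow> f i \<in> class_G (\<beta> i)"
    and \<gamma>: "(\<Sum>i=1..n. norm (\<gamma> i :: complex)) \<le> M"
    and h: "\<forall>i\<in>{1..n}. is_power_branch (deriv (f i)) (\<gamma> i) (h i)"
    and F_eq: "\<And>z. z \<in> unit_disc \<Longrightarrow>
      F z = contour_integral (linepath 0 z) (\<lambda>t. \<Prod>i=1..n. h i t)"
    using F unfolding integral_operator_class_def by blast
  obtain L where L: "\<And>i. i \<in> {1..n} \<Longrightarrow> L i holomorphic_on unit_disc"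
    and fL: "\<And>i z. i \<in> {1..n} \<Longrightarrow> z \<in> unit_disc \<Longrightarrow> deriv (f i) z = exp (L i z)"
    and hL: "\<And>i z. i \<in> {1..n} \<Longrightarrow> z \<in> unit_disc \<Longrightarrow> h i z = exp (\<gamma> i * L i z)"
    using h unfolding is_power_branch_def by metis
  have "deriv F z = exp (\<Sum>i=1..n. \<gamma> i * L i z)" if "z \<in> unit_disc" for z
  proof (rule deriv_integral_of_exp[OF _ _ F_eq that])
    show "(\<lambda>z. \<Sum>i=1..n. \<gamma> i * L i z) holomorphic_on unit_disc"
      by (intro holomorphic_intros L)
    show "(\<Prod>i=1..n. h i w) = exp (\<Sum>i=1..n. \<gamma> i * L i w)" if "w \<in> unit_disc" for w
      using that by (simp add: exp_sum hL)
  qed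
  with f \<gamma> L fL show ?thesis
    by (rule that)
qed

section \<open>Convexity on circles: the lower bound\<close>

text \<open>The minimum is attained because the circle is compact and
  \<open>convexity_expr F\<close>, expressed through \<open>deriv L\<close>, is continuous on
  it.\<close>

lemma nonneg_min_on_circle_iff:
  assumes L: "L holomorphic_on unit_disc"
    "\<And>z. z \<in> unit_disc \<Longrightarrow> deriv F z = exp (L z)"
    and r: "0 < r" "r < 1"
  shows "nonneg_min_on_circle F r \<longleftrightarrow> (\<forall>z\<in>sphere 0 r. 0 \<le> convexity_expr F z)"
proof
  assume "nonneg_min_on_circle F r"
  then show "\<forall>z\<in>sphere 0 r. 0 \<le> convexity_expr F z"
    unfolding nonneg_min_on_circle_def is_arg_min_def by fastforce
next
  assume nonneg: "\<forall>z\<in>sphere 0 r. 0 \<le> convexity_expr F z"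
  have sub: "sphere 0 r \<subseteq> unit_disc"
    using r by auto
  have "(\<lambda>z. z * deriv L z) holomorphic_on unit_disc"
    by (intro holomorphic_intros holomorphic_deriv L) auto
  then have "continuous_on (sphere 0 r) (\<lambda>z. z * deriv L z)"
    using holomorphic_on_imp_continuous_on continuous_on_subset sub by blast
  then have "continuous_on (sphere 0 r) (\<lambda>z. Re (1 + z * deriv L z))"
    by (intro continuous_on_Re continuous_on_add continuous_on_const)
  then have "continuous_on (sphere 0 r) (convexity_expr F)"
    using sub convexity_expr_of_exp[OF L] by (subst continuous_on_cong[OF refl]) auto
  moreover have "compact (sphere 0 r :: complex set)" "sphere 0 r \<noteq> ({} :: complex set)"
    using r by auto
  ultimately obtain w where "w \<in> sphere 0 r"
    "\<forall>z\<in>sphere 0 r. convexity_expr F w \<le> convexity_expr F z"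
    using continuous_attains_inf by blast
  then show "nonneg_min_on_circle F r"
    using nonneg unfolding nonneg_min_on_circle_def is_arg_min_def by fastforce
qed

lemma integral_operator_class_convexity_bound:
  assumes \<beta>: "\<And>i. i \<in> {1..n} \<Longrightarrow> 0 < \<beta> i" "\<And>i. i \<in> {1..n} \<Longrightarrow> \<beta> i \<le> b" and b: "b > 0"
    and F: "F \<in> integral_operator_class n \<beta> M"
    and z: "z \<in> unit_disc"
  shows "1 - b * M * norm z / (1 - norm z) \<le> convexity_expr F z"
proof -
  obtain f \<gamma> L where f: "\<And>i. i \<in> {1..n} \<Longrightarrow> f i \<in> class_G (\<beta> i)"
    and \<gamma>: "(\<Sum>i=1..n. norm (\<gamma> i :: complex)) \<le> M"
    and L: "\<And>i. i \<in> {1..n} \<Longrightarrow> L i holomorphic_on unit_disc"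
    and fL: "\<And>i z. i \<in> {1..n} \<Longrightarrow> z \<in> unit_disc \<Longrightarrow> deriv (f i) z = exp (L i z)"
    and FL: "\<And>z. z \<in> unit_disc \<Longrightarrow> deriv F z = exp (\<Sum>i=1..n. \<gamma> i * L i z)"
    using F by (rule integral_operator_class_log_deriv) blast
  have S: "(\<lambda>z. \<Sum>i=1..n. \<gamma> i * L i z) holomorphic_on unit_disc"
    by (intro holomorphic_intros L)
  have "((\<lambda>z. \<Sum>i=1..n. \<gamma> i * L i z) has_field_derivative (\<Sum>i=1..n. \<gamma> i * deriv (L i) z)) (at z)"
    using L z by (intro DERIV_sum DERIV_cmult holomorphic_derivI[of _ unit_disc]) auto
  then have dS: "deriv (\<lambda>z. \<Sum>i=1..n. \<gamma> i * L i z) z = (\<Sum>i=1..n. \<gamma> i * deriv (L i) z)"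
    by (rule DERIV_imp_deriv)
  \<comment> \<open>Nonnegativity of this factor allows each \<open>\<beta> i\<close> to be raised
    to \<open>b\<close> and the sum of the weights to \<open>M\<close>.\<close>
  let ?q = "norm z / (1 - norm z)"
  have q: "?q \<ge> 0"
    using z by simp
  have "norm (z * (\<Sum>i=1..n. \<gamma> i * deriv (L i) z))
      = norm (\<Sum>i=1..n. \<gamma> i * (z * deriv (L i) z))"
    by (simp add: sum_distrib_left mult.left_commute)
  also have "\<dots> \<le> (\<Sum>i=1..n. norm (\<gamma> i) * (b * ?q))"
  proof (rule sum_norm_le)
    fix i assume i: "i \<in> {1..n}"
    have "norm (z * deriv (L i) z) \<le> \<beta> i * norm z / (1 - norm z)"
      by (rule class_G_log_deriv_bound[OF \<beta>(1)[OF i] f[OF i] L[OF i] fL[OF i] z])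
    also have "\<dots> \<le> b * ?q"
      using mult_right_mono[OF \<beta>(2)[OF i] q] by simp
    finally show "norm (\<gamma> i * (z * deriv (L i) z)) \<le> norm (\<gamma> i) * (b * ?q)"
      by (simp only: norm_mult[of "\<gamma> i"] mult_left_mono norm_ge_zero)
  qed
  also have "\<dots> = (\<Sum>i=1..n. norm (\<gamma> i)) * (b * ?q)"
    by (simp only: sum_distrib_right)
  also have "\<dots> \<le> M * (b * ?q)"
    using \<gamma> b q by (intro mult_right_mono mult_nonneg_nonneg) auto
  finally have "norm (z * (\<Sum>i=1..n. \<gamma> i * deriv (L i) z)) \<le> b * M * norm z / (1 - norm z)"
    by (simp add: mult_ac)
  moreover have "convexity_expr F z = Re (1 + z * deriv (\<lambda>z. \<Sum>i=1..n. \<gamma> i * L i z) z)"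
    by (rule convexity_expr_of_exp[OF S _ z]) (rule FL)
  then have "convexity_expr F z = 1 + Re (z * (\<Sum>i=1..n. \<gamma> i * deriv (L i) z))"
    by (simp only: dS plus_complex.sel one_complex.sel)
  \<comment> \<open>The exponents have arbitrary arguments, so the real part is bounded below by
    minus the modulus.\<close>
  ultimately show ?thesis
    using abs_Re_le_cmod[of "z * (\<Sum>i=1..n. \<gamma> i * deriv (L i) z)"] by linarith
qed

section \<open>The extremal functions\<close>

lemma Re_one_minus_pos: "z \<in> unit_disc \<Longrightarrow> 0 < Re (1 - z)"
  using complex_Re_le_cmod[of z] by simp

text \<open>Makes the principal \<open>Ln\<close> and \<open>powr\<close> analytic at
  \<open>1 - z\<close>, so the extremal functions can be written with them.\<close>

lemma one_minus_notin_nonpos_Reals: "z \<in> unit_disc \<Longrightarrow> 1 - z \<notin> \<real>\<^sub>\<le>\<^sub>0"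
  using Re_one_minus_pos[of z] by (auto simp: complex_nonpos_Reals_iff)

definition log_extremal_deriv :: "real \<Rightarrow> complex \<Rightarrow> complex" where
  "log_extremal_deriv b z = b * Ln (1 - z)"

text \<open>For \<open>b > 0\<close>, the primitive of \<open>(1 - z) powr b\<close> on the disc
  that vanishes at the origin.\<close>

definition extremal :: "real \<Rightarrow> complex \<Rightarrow> complex" where
  "extremal b z = (1 - (1 - z) powr (b + 1)) / (b + 1)"

lemma holomorphic_log_extremal_deriv: "log_extremal_deriv b holomorphic_on unit_disc"
  unfolding log_extremal_deriv_def using one_minus_notin_nonpos_Reals
  by (intro holomorphic_intros) auto

lemma deriv_log_extremal_deriv:
  assumes "z \<in> unit_disc"
  shows "deriv (log_extremal_deriv b) z = - b / (1 - z)"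
  unfolding log_extremal_deriv_def using one_minus_notin_nonpos_Reals[OF assms]
  by (intro DERIV_imp_deriv) (auto intro!: derivative_eq_intros simp: field_simps)

lemma has_field_derivative_extremal:
  assumes b: "b > 0" and z: "z \<in> unit_disc"
  shows "(extremal b has_field_derivative exp (log_extremal_deriv b z)) (at z)"
proof -
  have nz: "1 - z \<noteq> 0"
    using Re_one_minus_pos[OF z] by force
  have b1: "complex_of_real b + 1 \<noteq> 0"
    using b by (metis add_pos_pos less_numeral_extra(1,3) of_real_1 of_real_add of_real_eq_0_iff)
  have "((\<lambda>z. (1 - z) powr (b + 1)) has_field_derivative
      (complex_of_real b + 1) * (1 - z) powr b * (0 - 1)) (at z)"
    using one_minus_notin_nonpos_Reals[OF z]
    by (auto intro!: derivative_eq_intros simp: powr_diff)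
  then have "(extremal b has_field_derivative
      (0 - (complex_of_real b + 1) * (1 - z) powr b * (0 - 1)) / (b + 1)) (at z)"
    unfolding extremal_def[abs_def] by (intro DERIV_cdivide DERIV_diff DERIV_const)
  moreover have "(0 - (complex_of_real b + 1) * (1 - z) powr b * (0 - 1)) / (b + 1)
      = exp (log_extremal_deriv b z)"
    using b1 nz by (simp add: powr_def log_extremal_deriv_def)
  ultimately show ?thesis
    by simp
qed

lemmas deriv_extremal = has_field_derivative_extremal[THEN DERIV_imp_deriv]

text \<open>Inversion carries the disc of radius 1 about 1, where \<open>1 - z\<close> lies, into
  the half-plane of real part above 1/2; subtracting 1 shifts it.\<close>

lemma Re_half_plane_map:
  assumes "z \<in> unit_disc"
  shows "- 1 / 2 < Re (z / (1 - z))"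
proof -
  have nz: "1 - z \<noteq> 0"
    using Re_one_minus_pos[OF assms] by force
  have "z / (1 - z) = 1 / (1 - z) - 1"
    using nz by (simp add: field_simps)
  moreover have "1 / 2 < Re (1 / (1 - z))"
  proof -
    have "(norm z)\<^sup>2 < 1"
      using assms by (simp add: power_less_one_iff abs_square_less_1)
    \<comment> \<open>The difference of the two sides is \<open>1 - |z|^2\<close>.\<close>
    then have "(norm (1 - z))\<^sup>2 < 2 * Re (1 - z)"
      unfolding cmod_power2 by (simp add: power2_eq_square algebra_simps)
    moreover have "Re (1 / (1 - z)) = Re (1 - z) / (norm (1 - z))\<^sup>2"
      by (simp add: Re_divide cmod_power2)
    ultimately show ?thesis
      using nz by (simp add: pos_less_divide_eq)
  qed
  ultimately show ?thesis
    by simp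
qed

text \<open>Here \<open>z f'' / f' = - b z / (1 - z)\<close>, and the bound -1/2 for the real part
  of \<open>z / (1 - z)\<close> yields exactly \<open>b / 2\<close>.\<close>

lemma extremal_in_class_G:
  assumes b: "b > 0"
  shows "extremal b \<in> class_G b"
proof -
  have "extremal b holomorphic_on unit_disc"
    using has_field_derivative_extremal[OF b] holomorphic_on_open open_ball by blast
  moreover have "extremal b 0 = 0"
    by (simp add: extremal_def)
  moreover have "deriv (extremal b) 0 = 1"
    using deriv_extremal[OF b, of 0] by (simp add: log_extremal_deriv_def)
  moreover have "convexity_expr (extremal b) z < 1 + b / 2" if z: "z \<in> unit_disc" for z
  proof -
    have "convexity_expr (extremal b) z = Re (1 + z * (- b / (1 - z)))"
      using convexity_expr_of_exp[OF holomorphic_log_extremal_deriv deriv_extremal[OF b] z]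
      by (simp add: deriv_log_extremal_deriv[OF z])
    also have "z * (- b / (1 - z)) = of_real (- b) * (z / (1 - z))"
      by simp
    also have "Re (1 + \<dots>) = 1 - b * Re (z / (1 - z))"
      by (simp only: plus_complex.sel one_complex.sel Re_complex_of_real times_complex.sel Im_complex_of_real)
    also have "\<dots> < 1 + b / 2"
      using mult_strict_left_mono[OF Re_half_plane_map[OF z] b] by simp
    finally show ?thesis .
  qed
  ultimately show ?thesis
    unfolding class_G_def class_A_def convexity_expr_def
    by (auto simp: deriv_extremal[OF b])
qed

section \<open>Sharpness\<close>

text \<open>Provides the member of the class that limits the radius. \<open>L\<close> is returned
  too, as a logarithm of \<open>deriv F\<close> for use with
  \<open>nonneg_min_on_circle_iff\<close>.\<close>

lemma integral_operator_class_sharp: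
  assumes \<beta>: "\<And>i. i \<in> {1..n} \<Longrightarrow> 0 < \<beta> i" and k: "k \<in> {1..n}" and M: "M > 0"
  obtains F L where "F \<in> integral_operator_class n \<beta> M"
    "L holomorphic_on unit_disc"
    "\<And>z. z \<in> unit_disc \<Longrightarrow> deriv F z = exp (L z)"
    "\<And>r. 0 < r \<Longrightarrow> r < 1 \<Longrightarrow> convexity_expr F (of_real r) = 1 - \<beta> k * M * r / (1 - r)"
proof -
  \<comment> \<open>All the weight sits on index \<open>k\<close>; the zero exponents turn the other
    factors into 1.\<close>
  define \<gamma> where "\<gamma> i = (if i = k then complex_of_real M else 0)" for i
  define h where "h i z = exp (\<gamma> i * log_extremal_deriv (\<beta> i) z)" for i z
  define F where "F z = contour_integral (linepath 0 z) (\<lambda>t. \<Prod>i=1..n. h i t)" for z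
  define L where "L z = M * log_extremal_deriv (\<beta> k) z" for z
  \<comment> \<open>The normalisation \<open>h i 0 = 1\<close> holds since
    \<open>log_extremal_deriv\<close> vanishes at 0.\<close>
  have pow: "is_power_branch (deriv (extremal (\<beta> i))) (\<gamma> i) (h i)" if "i \<in> {1..n}" for i
    unfolding is_power_branch_def
    using holomorphic_log_extremal_deriv[of "\<beta> i"] deriv_extremal[OF \<beta>[OF that]]
    by (auto simp: h_def log_extremal_deriv_def[of _ 0])
  have sum: "(\<Sum>i=1..n. norm (\<gamma> i)) \<le> M"
    using k M by (simp add: \<gamma>_def if_distrib[of norm] sum.delta cong: if_cong)
  have F: "F \<in> integral_operator_class n \<beta> M"
    unfolding integral_operator_class_def mem_Collect_eq
    using pow sum extremal_in_class_G[OF \<beta>]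
    by (intro exI[of _ "\<lambda>i. extremal (\<beta> i)"] exI[of _ \<gamma>] exI[of _ h]) (auto simp: F_def)
  have L: "L holomorphic_on unit_disc"
    unfolding L_def by (intro holomorphic_intros holomorphic_log_extremal_deriv)
  have "(\<Prod>i=1..n. h i z) = exp (L z)" for z
  proof -
    have "(\<Prod>i=1..n. h i z) = (\<Prod>i=1..n. if i = k then exp (L z) else 1)"
      by (intro prod.cong) (auto simp: h_def \<gamma>_def L_def)
    also have "\<dots> = exp (L z)"
      using k by (simp add: prod.delta)
    finally show ?thesis .
  qed
  then have FL: "deriv F z = exp (L z)" if "z \<in> unit_disc" for z
    using deriv_integral_of_exp[OF L _ F_def that] by simp
  have "convexity_expr F (of_real r) = 1 - \<beta> k * M * r / (1 - r)" if "0 < r" "r < 1" for r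
  proof -
    have r: "of_real r \<in> unit_disc"
      using that by simp
    have "(log_extremal_deriv (\<beta> k) has_field_derivative deriv (log_extremal_deriv (\<beta> k)) (of_real r))
        (at (of_real r))"
      using holomorphic_derivI[OF holomorphic_log_extremal_deriv open_ball r] .
    then have "deriv L (of_real r) = of_real M * (- of_real (\<beta> k) / (1 - of_real r))"
      unfolding L_def deriv_log_extremal_deriv[OF r] by (intro DERIV_imp_deriv DERIV_cmult)
    also have "\<dots> = of_real (M * (- \<beta> k / (1 - r)))"
      by simp
    finally have "1 + of_real r * deriv L (of_real r) = of_real (1 + r * (M * (- \<beta> k / (1 - r))))"
      by simp
    then have "convexity_expr F (of_real r) = 1 + r * (M * (- \<beta> k / (1 - r)))"
      using convexity_expr_of_exp[OF L FL r] by (simp only: Re_complex_of_real)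
    then show ?thesis
      by (simp add: mult_ac)
  qed
  with F L FL show ?thesis
    by (rule that)
qed

section \<open>The radius of convexity\<close>

theorem theorem2p3:
  fixes n :: nat and \<beta> :: "nat \<Rightarrow> real" and M :: real
  assumes "n \<ge> 1"
    and "\<And>i. i \<in> {1..n} \<Longrightarrow> 0 < \<beta> i \<and> \<beta> i \<le> 1"
    and "M > 0"
  shows "is_radius_of_convexity (integral_operator_class n \<beta> M)
           (1 / (Max (\<beta> ` {1..n}) * M + 1))"
proof -
  define b where "b = Max (\<beta> ` {1..n})"
  have fin: "finite (\<beta> ` {1..n})" "\<beta> ` {1..n} \<noteq> {}"
    using \<open>n \<ge> 1\<close> by auto
  have \<beta>: "0 < \<beta> i" "\<beta> i \<le> b" if "i \<in> {1..n}" for i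
    using assms(2) that fin by (auto simp: b_def)
  \<comment> \<open>An index attaining the maximum, at which the sharp example will be
    placed.\<close>
  obtain k where k: "k \<in> {1..n}" "\<beta> k = b"
    using Max_in[OF fin] by (auto simp: b_def)
  then have "b > 0"
    using \<beta>(1) by blast
  then have bM: "b * M > 0"
    using \<open>M > 0\<close> by simp
  define r where "r = 1 / (b * M + 1)"
  have r: "0 < r" "r < 1"
    using bM by (auto simp: r_def)
  \<comment> \<open>\<open>r\<close> is the radius at which the lower bound
    \<open>1 - b M r / (1 - r)\<close> is exactly 0.\<close>
  have "1 - r = b * M * r"
    using bM by (simp add: r_def field_simps)
  then have eq: "b * M * r / (1 - r) = 1"
    using r by (metis diff_gt_0_iff_gt divide_self less_irrefl)
  have "nonneg_min_on_circle F r" if F: "F \<in> integral_operator_class n \<beta> M" for F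
  proof -
    obtain \<gamma> L where L: "\<And>i. i \<in> {1..n} \<Longrightarrow> L i holomorphic_on unit_disc"
      and FL: "\<And>z. z \<in> unit_disc \<Longrightarrow> deriv F z = exp (\<Sum>i=1..n. \<gamma> i * L i z)"
      using F by (rule integral_operator_class_log_deriv) blast
    have S: "(\<lambda>z. \<Sum>i=1..n. \<gamma> i * L i z) holomorphic_on unit_disc"
      by (intro holomorphic_intros L)
    show ?thesis
    proof (rule nonneg_min_on_circle_iff[THEN iffD2, OF S _ r], fact FL, rule ballI)
      fix z :: complex
      assume "z \<in> sphere 0 r"
      then show "0 \<le> convexity_expr F z"
        using integral_operator_class_convexity_bound[OF \<beta> \<open>b > 0\<close> F, of z] r eq
        by (simp del: divide_eq_1_iff)
    qed
  qed
  moreover have "s \<le> r"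
    if s: "0 < s" "s < 1" and all: "\<forall>F\<in>integral_operator_class n \<beta> M. nonneg_min_on_circle F s" for s
  proof -
    obtain F L where F: "F \<in> integral_operator_class n \<beta> M"
      and L: "L holomorphic_on unit_disc"
        "\<And>z. z \<in> unit_disc \<Longrightarrow> deriv F z = exp (L z)"
      and F_real: "\<And>r. 0 < r \<Longrightarrow> r < 1 \<Longrightarrow>
        convexity_expr F (of_real r) = 1 - \<beta> k * M * r / (1 - r)"
      by (rule integral_operator_class_sharp[of n \<beta> k M, OF \<beta>(1) k(1) \<open>M > 0\<close>]) (assumption, rule that)
    \<comment> \<open>The sharp example is tested at the positive point of the circle; solving the
      resulting inequality for \<open>s\<close> gives \<open>s \<le> r\<close>.\<close>
    have "0 \<le> convexity_expr F (of_real s)"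
      using all F nonneg_min_on_circle_iff[OF L s] s
      by (metis abs_of_pos mem_sphere_0 norm_of_real)
    then have "b * M * s \<le> 1 - s"
      using s by (simp add: F_real k(2) pos_divide_le_eq)
    then show ?thesis
      using bM by (simp add: r_def pos_le_divide_eq algebra_simps)
  qed
  ultimately have "is_radius_of_convexity (integral_operator_class n \<beta> M) r"
    using r unfolding is_radius_of_convexity_def by auto
  then show ?thesis
    by (simp only: r_def b_def)
qed

end
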